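(* There is a bounded convex set $C'\subset\mathbb{R}^3$ with the following property. There exists a family of translates of $C=C'\times[0,\infty)\subset\mathbb{R}^4$ which covers every point of $\mathbb{R}^4$ infinitely many times (that is, every point of $\mathbb{R}^4$ belongs to infinitely many members of the family), but which cannot be split into two coverings.
   Context: The set $C'$ is not required to be open or closed. A family of subsets of $\mathbb{R}^4$ is a covering if every point of $\mathbb{R}^4$ belongs to at least one of its members. A family can be split into two coverings if it can be partitioned into two subfamilies, each of which is a covering of $\mathbb{R}^4$. *)

theory Defs
  imports "HOL-Analysis.Analysis"
begin

definition covering :: "'a set set \<Rightarrow> bool" where
  "covering \<F> \<longleftrightarrow> (\<forall>x. \<exists>A\<in>\<F>. x \<in> A)"

definition splits_into_two_coverings :: "'a set set \<Rightarrow> bool" where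
  "splits_into_two_coverings \<F> \<longleftrightarrow>
     (\<exists>\<A> \<B>. \<A> \<union> \<B> = \<F> \<and> \<A> \<inter> \<B> = {} \<and> covering \<A> \<and> covering \<B>)"

definition covers_infinitely_often :: "'a set set \<Rightarrow> bool" where
  "covers_infinitely_often \<F> \<longleftrightarrow> (\<forall>x. infinite {A \<in> \<F>. x \<in> A})"

text \<open>Families are sets of sets, so a translate occurs at most once in a family.\<close>

definition family_of_translates :: "'a::plus set \<Rightarrow> 'a set set \<Rightarrow> bool" where
  "family_of_translates C \<F> \<longleftrightarrow> (\<forall>A\<in>\<F>. \<exists>v. A = (\<lambda>x. v + x) ` C)"

text \<open>Four-dimensional space is represented as the product of \<open>real ^ 3\<close> and \<open>real\<close>,
  so that the half-infinite cylinder over \<open>C'\<close> is literally a Cartesian product.\<close>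

definition half_cylinder :: "(real ^ 3) set \<Rightarrow> ((real ^ 3) \<times> real) set" where
  "half_cylinder C' = C' \<times> {0..}"

end

theory Submission
  imports Defs
begin

text \<open>
  A point \<open>(p, t)\<close> lies in the translate of \<open>C' \<times> [0,\<infinity>)\<close> by \<open>(v, h)\<close> iff \<open>p - v \<in> C'\<close> and \<open>h \<le> t\<close>.
  So it suffices to find \<open>C'\<close>, positions \<open>v\<^sub>0, v\<^sub>1, \<dots>\<close> and, for every infinite \<open>A \<subseteq> \<nat>\<close>, a point
  \<open>p\<^sub>A\<close> with \<open>p\<^sub>A \<in> v\<^sub>i + C'\<close> iff \<open>i \<in> A\<close>. Placing the \<open>i\<close>-th translate at height \<open>-i\<close> makes every
  point \<open>(p\<^sub>A, t)\<close> covered infinitely often, while in any partition into two subfamilies one of the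
  parts contains the \<open>i\<close>-th translate for all \<open>i\<close> in an infinite set \<open>A\<close>, and then the other part
  misses \<open>(p\<^sub>A, 0)\<close>, provided that no further member of the family covers it.

  The sets \<open>A\<close> are realised on a paraboloid. The sections of \<open>y = x\<^sup>2 + z\<^sup>2\<close> by the planes \<open>z = s\<close> are
  all translates of one parabola. So the points \<open>v\<^sub>i\<close> can be put on a (reflected) parabola in such
  a way that, for each \<open>s\<close>, the translation bringing the section \<open>z = s\<close> into position puts all of
  them on the boundary at once. Every boundary point of the solid paraboloid is extreme, hence
  boundary points may be deleted at will without destroying convexity. As there are continuum many
  sections, each infinite \<open>A\<close> gets a section of its own, from which the points belonging to
  \<open>i \<notin> A\<close> are deleted.

  Finally the points over a \<open>q\<close> that is none of the \<open>p\<^sub>A\<close> must be covered. For this all translates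
  of \<open>C'\<close> avoiding every \<open>p\<^sub>A\<close> are added, at all heights \<open>0, -1, -2, \<dots>\<close>. One of them contains \<open>q\<close>,
  because \<open>(1,1,0)\<close> and \<open>(-1,1,0)\<close> are the only points of \<open>C'\<close> with extremal first coordinate, and
  all the \<open>p\<^sub>A\<close> lie in the plane \<open>x = 0\<close>.
\<close>

section \<open>Translates of a half-cylinder\<close>

definition cylinder_at :: "(real^3) set \<Rightarrow> real^3 \<Rightarrow> real \<Rightarrow> ((real^3) \<times> real) set" where
  "cylinder_at C v h = (\<lambda>x. (v, h) + x) ` half_cylinder C"

lemma mem_cylinder_at: "(p, t) \<in> cylinder_at C v h \<longleftrightarrow> p - v \<in> C \<and> h \<le> t"
proof
  assume "(p, t) \<in> cylinder_at C v h"
  then show "p - v \<in> C \<and> h \<le> t"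
    by (auto simp: cylinder_at_def half_cylinder_def)
next
  assume "p - v \<in> C \<and> h \<le> t"
  then have "(p - v, t - h) \<in> half_cylinder C" by (simp add: half_cylinder_def)
  moreover have "(p, t) = (v, h) + (p - v, t - h)" by simp
  ultimately show "(p, t) \<in> cylinder_at C v h" unfolding cylinder_at_def by blast
qed

text \<open>The height is recovered as the least last coordinate. Families are sets, so this is what
  keeps translates at infinitely many heights from collapsing to finitely many members.\<close>

lemma cylinder_at_height_unique:
  assumes "c \<in> C" and eq: "cylinder_at C v h = cylinder_at C v' h'"
  shows "h = h'"
proof -
  have "(v + c, h) \<in> cylinder_at C v h" "(v' + c, h') \<in> cylinder_at C v' h'"
    using assms(1) by (simp_all add: mem_cylinder_at)
  then have "(v + c, h) \<in> cylinder_at C v' h'" "(v' + c, h') \<in> cylinder_at C v h"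
    by (simp_all add: eq)
  then show ?thesis by (simp add: mem_cylinder_at)
qed

text \<open>Only indices \<open>n \<ge> -t\<close> are high enough to be relevant at height \<open>t\<close>, so discarding
  finitely many indices suffices at every height.\<close>

lemma infinitely_many_covering_cylinders:
  assumes "infinite A" and "\<And>n. n \<in> A \<Longrightarrow> p - v n \<in> C"
    and "\<And>n. n \<in> A \<Longrightarrow> cylinder_at C (v n) (- real n) \<in> \<F>"
  shows "infinite {S \<in> \<F>. (p, t) \<in> S}"
proof -
  define B where "B = A - {..<nat \<lceil>- t\<rceil>}"
  have "infinite B" using assms(1) by (simp add: B_def)
  moreover obtain c where "c \<in> C"
    using assms(1,2) by (metis finite.emptyI equals0I)
  then have "inj_on (\<lambda>n. cylinder_at C (v n) (- real n)) B"
    by (auto intro!: inj_onI dest: cylinder_at_height_unique)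
  ultimately have "infinite ((\<lambda>n. cylinder_at C (v n) (- real n)) ` B)"
    by (simp add: finite_image_iff)
  moreover have "(\<lambda>n. cylinder_at C (v n) (- real n)) ` B \<subseteq> {S \<in> \<F>. (p, t) \<in> S}"
  proof -
    have "- real n \<le> t" if "n \<in> B" for n
      using that by (simp add: B_def) linarith
    then show ?thesis using assms by (auto simp: mem_cylinder_at B_def)
  qed
  ultimately show ?thesis by (rule infinite_super[rotated])
qed

section \<open>The truncated paraboloid\<close>

definition paraboloid :: "(real^3) set" where
  "paraboloid = {p. (p$1)\<^sup>2 + (p$3)\<^sup>2 \<le> p$2 \<and> p$2 \<le> 1}"

lemma convex_combination_square:
  fixes a b u :: real
  shows "((1 - u) * a + u * b)\<^sup>2 = (1 - u) * a\<^sup>2 + u * b\<^sup>2 - u * (1 - u) * (a - b)\<^sup>2"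
  by (simp add: power2_eq_square algebra_simps)

lemma convex_paraboloid: "convex paraboloid"
proof -
  have sq: "convex_on UNIV (\<lambda>p::real^3. (p$i)\<^sup>2)" for i
  proof (rule convex_onI)
    fix t :: real and x y :: "real^3"
    assume t: "0 < t" "t < 1"
    have "0 \<le> t * (1 - t) * (x$i - y$i)\<^sup>2" using t by simp
    then show "(((1 - t) *\<^sub>R x + t *\<^sub>R y)$i)\<^sup>2 \<le> (1 - t) * (x$i)\<^sup>2 + t * (y$i)\<^sup>2"
      by (simp add: convex_combination_square)
  qed simp
  show ?thesis
  proof (rule convexI)
    fix x y :: "real^3" and u v :: real
    assume x: "x \<in> paraboloid" and y: "y \<in> paraboloid"
      and uv: "0 \<le> u" "0 \<le> v" "u + v = 1"
    let ?z = "u *\<^sub>R x + v *\<^sub>R y"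
    have "(?z$i)\<^sup>2 \<le> u * (x$i)\<^sup>2 + v * (y$i)\<^sup>2" for i
      using sq[of i] uv unfolding convex_on_def by blast
    from this[of 1] this[of 3]
    have "(?z$1)\<^sup>2 + (?z$3)\<^sup>2 \<le> u * ((x$1)\<^sup>2 + (x$3)\<^sup>2) + v * ((y$1)\<^sup>2 + (y$3)\<^sup>2)"
      by (simp add: algebra_simps)
    also have "\<dots> \<le> u * x$2 + v * y$2"
      using x y uv by (intro add_mono mult_left_mono) (auto simp: paraboloid_def)
    finally have "(?z$1)\<^sup>2 + (?z$3)\<^sup>2 \<le> ?z$2" by simp
    moreover have "?z$2 \<le> 1"
      using convex_bound_le[of "x$2" 1 "y$2" u v] x y uv by (simp add: paraboloid_def)
    ultimately show "?z \<in> paraboloid" by (simp add: paraboloid_def)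
  qed
qed

text \<open>Strict convexity of \<open>x\<^sup>2 + z\<^sup>2\<close>: a nondegenerate segment in the solid that passes through a point of
  the surface would have to be vertical, and a vertical segment meets the surface only at its
  lower end.\<close>

lemma extreme_point_of_paraboloid:
  assumes p: "p \<in> paraboloid" and surf: "p$2 = (p$1)\<^sup>2 + (p$3)\<^sup>2"
  shows "p extreme_point_of paraboloid"
  unfolding extreme_point_of_def
proof (intro conjI ballI notI p)
  fix a b
  assume a: "a \<in> paraboloid" and b: "b \<in> paraboloid" and "p \<in> open_segment a b"
  then obtain u where u: "0 < u" "u < 1" and ab: "a \<noteq> b" and pu: "p = (1 - u) *\<^sub>R a + u *\<^sub>R b"
    by (auto simp: in_segment)
  have comp: "p$i = (1 - u) * a$i + u * b$i" for i using pu by simp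
  have low: "(1 - u) * ((a$1)\<^sup>2 + (a$3)\<^sup>2) \<le> (1 - u) * a$2" "u * ((b$1)\<^sup>2 + (b$3)\<^sup>2) \<le> u * b$2"
    using a b u by (auto simp: paraboloid_def)
  have "u * (1 - u) * ((a$1 - b$1)\<^sup>2 + (a$3 - b$3)\<^sup>2) \<le> 0"
    using low surf unfolding comp convex_combination_square by (simp add: algebra_simps)
  moreover have "0 < u * (1 - u)" using u by simp
  ultimately have "(a$1 - b$1)\<^sup>2 + (a$3 - b$3)\<^sup>2 \<le> 0"
    by (metis mult_le_0_iff not_less)
  then have eq13: "a$1 = b$1" "a$3 = b$3"
    by (simp_all add: sum_power2_le_zero_iff)
  then have p13: "p$1 = a$1" "p$3 = a$3" unfolding comp by (simp_all add: algebra_simps)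
  have "p$2 \<le> a$2" "p$2 \<le> b$2" using a b eq13 p13 surf by (auto simp: paraboloid_def)
  moreover have "(1 - u) * (a$2 - p$2) + u * (b$2 - p$2) = 0"
    using comp[of 2] by (simp add: algebra_simps)
  ultimately have "(1 - u) * (a$2 - p$2) = 0" "u * (b$2 - p$2) = 0"
    using u by (simp_all add: add_nonneg_eq_0_iff)
  then have "a$2 = b$2" using u by simp
  with eq13 ab show False by (simp add: vec_eq_iff forall_3)
qed

lemma convex_minus_extreme_points:
  assumes "convex S" and "\<And>x. x \<in> T \<Longrightarrow> x extreme_point_of S"
  shows "convex (S - T)"
proof -
  have eq: "S - T = S \<inter> (\<Inter>x\<in>T. S - {x})" by auto
  have "convex (S - {x})" if "x \<in> T" for x
    using assms(2)[OF that] extreme_point_of_stillconvex[OF assms(1)] by blast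
  then show ?thesis unfolding eq by (intro convex_Int convex_INT assms(1))
qed

lemma paraboloid_first_coordinate:
  assumes "p \<in> paraboloid"
  shows "\<bar>p$1\<bar> \<le> 1"
proof -
  have "(p$1)\<^sup>2 \<le> 1" using assms zero_le_power2[of "p$3"]
    unfolding paraboloid_def mem_Collect_eq by linarith
  then show ?thesis by (simp add: abs_square_le_1)
qed

text \<open>This rigidity pins down a translate of the solid from a single one of its points, once that
  point is known to be extremal in the direction of the first coordinate.\<close>

lemma paraboloid_tip:
  assumes "p \<in> paraboloid" and "\<bar>p$1\<bar> = 1"
  shows "p$2 = 1 \<and> p$3 = 0"
proof -
  have "(p$1)\<^sup>2 = 1" using assms(2) by (simp add: abs_square_eq_1)
  with assms(1) have "1 + (p$3)\<^sup>2 \<le> p$2" "p$2 \<le> 1" by (auto simp: paraboloid_def)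
  moreover have "(p$3)\<^sup>2 \<ge> 0" by simp
  ultimately have "(p$3)\<^sup>2 = 0" "p$2 = 1" by linarith+
  then show ?thesis by simp
qed

lemma bounded_paraboloid: "bounded paraboloid"
proof -
  have "norm p \<le> 3" if p: "p \<in> paraboloid" for p
  proof -
    have "(p$3)\<^sup>2 \<le> 1" using p zero_le_power2[of "p$1"]
      unfolding paraboloid_def mem_Collect_eq by linarith
    then have "\<bar>p$3\<bar> \<le> 1" by (simp add: abs_square_le_1)
    moreover have "0 \<le> p$2"
      using p zero_le_power2[of "p$1"] zero_le_power2[of "p$3"]
      unfolding paraboloid_def mem_Collect_eq by linarith
    then have "\<bar>p$2\<bar> \<le> 1" using p by (simp add: paraboloid_def)
    moreover have "norm p \<le> (\<Sum>i\<in>UNIV. \<bar>p$i\<bar>)" by (rule norm_le_l1_cart)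
    ultimately show ?thesis using paraboloid_first_coordinate[OF p] by (simp add: sum_3)
  qed
  then show ?thesis unfolding bounded_iff by blast
qed

section \<open>Assigning sections of the paraboloid to sets of indices\<close>

text \<open>The section assigned to \<open>A\<close> is the one in the plane \<open>z = code A\<close>. The values stay below \<open>1/2\<close> so
  that the deleted points lie well inside the truncation, away from the tips.\<close>

definition code :: "nat set \<Rightarrow> real" where
  "code = (SOME f. inj f \<and> range f \<subseteq> {0..<1/2})"

lemma inj_code: "inj code" and code_range: "code A \<in> {0..<1/2}"
proof -
  obtain f :: "nat set \<Rightarrow> real" where f: "inj f" "range f \<subseteq> {0..<1}"
    using nat_sets_lepoll_reals01 unfolding lepoll_def by blast
  have "inj (\<lambda>A. f A / 2)" using f(1) by (simp add: inj_def)
  moreover have "range (\<lambda>A. f A / 2) \<subseteq> {0..<1/2}" using f(2) by force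
  ultimately have "\<exists>f. inj (f :: nat set \<Rightarrow> real) \<and> range f \<subseteq> {0..<1/2}" by blast
  then have "inj code \<and> range code \<subseteq> {0..<1/2}"
    unfolding code_def by (rule someI_ex)
  then show "inj code" "code A \<in> {0..<1/2}" by blast+
qed

definition abscissa :: "nat \<Rightarrow> real" where
  "abscissa i = 1 / (real i + 2)"

lemma abscissa_bounds: "0 < abscissa i" "abscissa i \<le> 1/2"
  by (simp_all add: abscissa_def field_simps)

lemma abscissa_eq_iff: "abscissa i = abscissa j \<longleftrightarrow> i = j"
  by (simp add: abscissa_def field_simps)

definition surface_point :: "nat \<Rightarrow> nat set \<Rightarrow> real^3" where
  "surface_point i A = vector [abscissa i, (abscissa i)\<^sup>2 + (code A)\<^sup>2, code A]"

definition position :: "nat \<Rightarrow> real^3" where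
  "position i = vector [- abscissa i, - (abscissa i)\<^sup>2, 0]"

definition witness :: "nat set \<Rightarrow> real^3" where
  "witness A = vector [0, (code A)\<^sup>2, code A]"

text \<open>The sections \<open>z = code A\<close> are translates of one another: this is where the form of the
  paraboloid enters.\<close>

lemma witness_minus_position: "witness A - position i = surface_point i A"
  by (simp add: vec_eq_iff forall_3 witness_def position_def surface_point_def)

lemma surface_point_eq_iff: "surface_point i A = surface_point j B \<longleftrightarrow> i = j \<and> A = B"
  by (auto simp: vec_eq_iff forall_3 surface_point_def abscissa_eq_iff inj_eq[OF inj_code])

lemma surface_point_in_paraboloid: "surface_point i A \<in> paraboloid"
proof -
  have "(abscissa i)\<^sup>2 \<le> (1/2)\<^sup>2" "(code A)\<^sup>2 \<le> (1/2)\<^sup>2"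
    using abscissa_bounds[of i] code_range[of A] by (intro power_mono; simp)+
  then show ?thesis by (simp add: paraboloid_def surface_point_def power2_eq_square)
qed

section \<open>The unsplittable family\<close>

definition base :: "(real^3) set" where
  "base = paraboloid - {surface_point i A |i A. i \<notin> A}"

lemma convex_base: "convex base"
  unfolding base_def
proof (rule convex_minus_extreme_points[OF convex_paraboloid])
  fix x assume "x \<in> {surface_point i A |i A. i \<notin> A}"
  then obtain i A where x: "x = surface_point i A" by blast
  show "x extreme_point_of paraboloid"
    unfolding x by (rule extreme_point_of_paraboloid[OF surface_point_in_paraboloid])
      (simp add: surface_point_def)
qed

lemma bounded_base: "bounded base"
  using bounded_paraboloid by (rule bounded_subset) (auto simp: base_def)

lemma witness_in_translate: "witness A - position i \<in> base \<longleftrightarrow> i \<in> A"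
  by (auto simp: base_def witness_minus_position surface_point_in_paraboloid surface_point_eq_iff)

lemma tips_in_base: "vector [1, 1, 0] \<in> base" "vector [-1, 1, 0] \<in> base"
proof -
  have "surface_point i A $ 1 \<noteq> 1" "surface_point i A $ 1 \<noteq> -1" for i A
    using abscissa_bounds[of i] by (simp_all add: surface_point_def)
  then have "vector [1, 1, 0] \<noteq> surface_point i A" "vector [-1, 1, 0] \<noteq> surface_point i A" for i A
    by (metis vector_3(1))+
  then show "vector [1, 1, 0] \<in> base" "vector [-1, 1, 0] \<in> base"
    by (auto simp: base_def paraboloid_def)
qed

definition witness_free :: "(real^3) set" where
  "witness_free = {w. \<forall>A. infinite A \<longrightarrow> witness A - w \<notin> base}"

text \<open>Consider the two translates that have \<open>q\<close> as a tip. If both contain witnesses then, all witnesses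
  having first coordinate \<open>0\<close>, the first of these tips gives \<open>q$1 \<ge> 0\<close> and the second \<open>q$1 \<le> 0\<close>. So
  \<open>q$1 = 0\<close>, a witness in the first translate is extremal there, and it coincides with the tip \<open>q\<close>.\<close>

lemma witness_free_translate_exists:
  assumes "\<And>A. infinite A \<Longrightarrow> q \<noteq> witness A"
  obtains w where "w \<in> witness_free" "q - w \<in> base"
proof -
  let ?r = "vector [1, 1, 0] :: real^3" and ?l = "vector [-1, 1, 0] :: real^3"
  have "q - ?r \<in> witness_free \<or> q - ?l \<in> witness_free"
  proof (rule ccontr)
    assume "\<not> ?thesis"
    then obtain A B where A: "infinite A" "witness A - (q - ?r) \<in> paraboloid"
      and B: "witness B - (q - ?l) \<in> paraboloid"
      by (auto simp: witness_free_def base_def)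
    have "q$1 = 0"
      using paraboloid_first_coordinate[OF A(2)] paraboloid_first_coordinate[OF B]
      by (simp add: witness_def abs_le_iff)
    then have "witness A = q"
      using paraboloid_tip[OF A(2)] by (auto simp: vec_eq_iff forall_3 witness_def)
    with A(1) assms show False by blast
  qed
  then show ?thesis using that[of "q - ?r"] that[of "q - ?l"] tips_in_base by auto
qed

definition family :: "((real^3) \<times> real) set set" where
  "family = range (\<lambda>i. cylinder_at base (position i) (- real i))
     \<union> {cylinder_at base w (- real n) |w n. w \<in> witness_free}"

lemma family_translates: "family_of_translates (half_cylinder base) family"
  unfolding family_of_translates_def family_def cylinder_at_def by blast

lemma family_covers_infinitely_often: "covers_infinitely_often family"
  unfolding covers_infinitely_often_def
proof (intro allI)
  fix x :: "(real^3) \<times> real"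
  obtain q t where x: "x = (q, t)" by fastforce
  show "infinite {S \<in> family. x \<in> S}"
  proof (cases "\<exists>A. infinite A \<and> q = witness A")
    case True
    then obtain A where A: "infinite A" "q = witness A" by blast
    show ?thesis unfolding x
      by (rule infinitely_many_covering_cylinders[OF A(1), of _ position base])
        (auto simp: A(2) witness_in_translate family_def)
  next
    case False
    then obtain w where w: "w \<in> witness_free" "q - w \<in> base"
      using witness_free_translate_exists[of q] by blast
    show ?thesis unfolding x
      by (rule infinitely_many_covering_cylinders[of UNIV _ "\<lambda>_. w" base])
        (use w in \<open>auto simp: family_def\<close>)
  qed
qed

text \<open>Every member through the witness over \<open>A\<close> is one of the cylinders with index in \<open>A\<close>; if they all
  belong to the rest of the family, nothing in \<open>\<G>\<close> covers the witness.\<close>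

lemma subfamily_misses_witness:
  assumes "\<G> \<subseteq> family" and "infinite A"
    and "\<And>i. i \<in> A \<Longrightarrow> cylinder_at base (position i) (- real i) \<notin> \<G>"
  shows "\<not> covering \<G>"
proof
  assume "covering \<G>"
  then obtain S where S: "S \<in> \<G>" "(witness A, 0) \<in> S" unfolding covering_def by blast
  with assms(1) consider i where "S = cylinder_at base (position i) (- real i)"
    | w n where "w \<in> witness_free" "S = cylinder_at base w (- real n)"
    unfolding family_def by blast
  then show False
  proof cases
    case 1
    with S(2) have "i \<in> A" by (simp add: mem_cylinder_at witness_in_translate)
    with assms(3) S(1) 1 show False by blast
  next
    case 2
    with S(2) assms(2) show False by (auto simp: mem_cylinder_at witness_free_def)
  qed
qed

lemma family_not_splittable: "\<not> splits_into_two_coverings family"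
proof
  assume "splits_into_two_coverings family"
  then obtain \<A> \<B> where AB: "\<A> \<union> \<B> = family" "\<A> \<inter> \<B> = {}" "covering \<A>" "covering \<B>"
    unfolding splits_into_two_coverings_def by blast
  define R where "R = {i. cylinder_at base (position i) (- real i) \<in> \<A>}"
  consider "infinite R" | "infinite (- R)"
    by (metis finite_Un Compl_partition infinite_UNIV_nat)
  then show False
  proof cases
    case 1
    have "\<not> covering \<B>"
      by (rule subfamily_misses_witness[OF _ 1]) (use AB in \<open>auto simp: R_def\<close>)
    with AB(4) show False by blast
  next
    case 2
    have "\<not> covering \<A>"
      by (rule subfamily_misses_witness[OF _ 2]) (use AB in \<open>auto simp: R_def\<close>)
    with AB(3) show False by blast
  qed
qed

theorem theorem8:
  "\<exists>C' :: (real ^ 3) set.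
     bounded C' \<and> convex C' \<and>
     (\<exists>\<F> :: ((real ^ 3) \<times> real) set set.
        family_of_translates (half_cylinder C') \<F> \<and>
        covers_infinitely_often \<F> \<and>
        \<not> splits_into_two_coverings \<F>)"
  by (intro exI conjI)
    (rule bounded_base convex_base family_translates family_covers_infinitely_often
      family_not_splittable)+

end
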